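(* Let $d\ge 2$ and $s\ge 1$ be integers with $\gcd(s,d)=1$, and put $n=(3^d-1)/2$. Let $c\in\mathbb F_{3^d}^*$ be such that $-c$ is a nonsquare in $\mathbb F_{3^d}$, let $k$ be a positive integer with $\gcd(k,n)=1$, and define $H_{k,c,s}(x)=x^{k3^s}+cx^k$. Let $\alpha$ be a primitive element of $\mathbb F_{3^d}$. For each $i\in\mathbb Z_n$, define $F_{k,c,s}(i)$ to be the unique $j\in\mathbb Z_n$ such that $H_{k,c,s}(\alpha^i)\in\{\alpha^j,-\alpha^j\}$. Then $F_{k,c,s}$ is an APN permutation of $\mathbb Z_n$. In particular, $c=-\alpha$ is an admissible choice and gives an explicit member for every $d\ge 2$, every $s\geq 1$ coprime to $d$, and every $k$ that is a unit modulo $n$.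
   Context: $\mathbb Z_n=\mathbb Z/n\mathbb Z$. The differential uniformity of $F:\mathbb Z_n\to\mathbb Z_n$ is $\delta(F)=\max_{a\neq 0,\,b\in\mathbb Z_n}\#\{x\in\mathbb Z_n: F(x+a)-F(x)=b\}$, and $F$ is called APN if $\delta(F)=2$. A primitive element of $\mathbb F_{3^d}$ is a generator of $\mathbb F_{3^d}^*$; the map $i\mapsto\{\alpha^i,-\alpha^i\}$ is a bijection from $\mathbb Z_n$ to $\mathbb F_{3^d}^*/\{\pm1\}$. *)

theory Defs
  imports "HOL-Library.Cardinality" "HOL-Computational_Algebra.Nth_Powers"
begin

text \<open>The ring of integers modulo \<open>n\<close> is represented by the least nonnegative residues.\<close>

definition Zmod :: "nat \<Rightarrow> int set" where
  "Zmod n = {0..<int n}"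

definition differential_uniformity :: "nat \<Rightarrow> (int \<Rightarrow> int) \<Rightarrow> nat" where
  "differential_uniformity n F =
     Max {card {x \<in> Zmod n. (F ((x + a) mod int n) - F x) mod int n = b} | a b.
            a \<in> Zmod n \<and> a \<noteq> 0 \<and> b \<in> Zmod n}"

definition APN :: "nat \<Rightarrow> (int \<Rightarrow> int) \<Rightarrow> bool" where
  "APN n F \<longleftrightarrow> differential_uniformity n F = 2"

definition APN_permutation :: "nat \<Rightarrow> (int \<Rightarrow> int) \<Rightarrow> bool" where
  "APN_permutation n F \<longleftrightarrow> bij_betw F (Zmod n) (Zmod n) \<and> APN n F"

definition primitive_element :: "'a::field \<Rightarrow> bool" where
  "primitive_element \<alpha> \<longleftrightarrow> range (\<lambda>i::int. \<alpha> powi i) = {x. x \<noteq> 0}"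

definition admissible :: "'a::field \<Rightarrow> bool" where
  "admissible c \<longleftrightarrow> c \<noteq> 0 \<and> \<not> is_square (- c)"

definition H :: "nat \<Rightarrow> 'a::field \<Rightarrow> nat \<Rightarrow> 'a \<Rightarrow> 'a" where
  "H k c s x = x ^ (k * 3 ^ s) + c * x ^ k"

text \<open>
  The index \<open>i\<close> ranges over all integers, so that it may be any representative of a residue
  class. The description is meaningful only if exactly one such \<open>j\<close> exists and it depends
  only on the class of \<open>i\<close>.
\<close>

definition F :: "'a::field \<Rightarrow> nat \<Rightarrow> nat \<Rightarrow> 'a \<Rightarrow> nat \<Rightarrow> int \<Rightarrow> int" where
  "F \<alpha> n k c s i =
     (THE j. j \<in> Zmod n \<and> H k c s (\<alpha> powi i) \<in> {\<alpha> powi j, - (\<alpha> powi j)})"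

end

theory Submission
  imports Defs "HOL-Number_Theory.Residues"
begin

text \<open>
  Write \<open>q = 3 ^ s\<close> and \<open>L y = y ^ q + c * y\<close>, so that \<open>H k c s x = L (x ^ k)\<close>. The map \<open>L\<close> is
  additive, because the characteristic is 3, and its kernel is trivial: a root \<open>y \<noteq> 0\<close> would give
  \<open>- c = y ^ (q - 1)\<close>, a square since \<open>q\<close> is odd. Hence \<open>L\<close> permutes the nonzero elements up to
  sign. Taking logarithms to base \<open>\<alpha>\<close> modulo \<open>n\<close> identifies the nonzero elements up to sign with
  the residues modulo \<open>n\<close>, and the power map \<open>x \<mapsto> x ^ k\<close> is multiplication by the unit \<open>k\<close> there, so
  \<open>F\<close> is a permutation.

  For the differential uniformity, a solution \<open>x\<close> of \<open>F (x + a) - F x = b\<close> corresponds, with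
  \<open>y = \<alpha> powi (k * x)\<close>, \<open>t = \<alpha> powi (k * a)\<close> and \<open>\<gamma> = \<plusminus> \<alpha> powi b\<close>, to a solution of
  \<open>L (t * y) = \<gamma> * L y\<close>, that is, of \<open>y ^ q * (t ^ q - \<gamma>) = - c * y * (t - \<gamma>)\<close>. As \<open>a \<noteq> 0\<close>,
  \<open>t\<close> is not \<open>\<plusminus> 1\<close>, so \<open>t ^ q \<noteq> t\<close>, because \<open>s\<close> and \<open>d\<close> are coprime and so \<open>y \<mapsto> y ^ q\<close> fixes only the
  prime field. Therefore \<open>t ^ q \<noteq> \<gamma>\<close>, and \<open>y ^ (q - 1)\<close> is determined by \<open>t\<close> and \<open>\<gamma>\<close>, which
  determines \<open>y\<close> up to sign. Each of the two signs of \<open>\<gamma>\<close> thus contributes at most one solution (lemma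
  \<open>twisted_eigenvector_unique\<close>). Two solutions do occur for some \<open>b\<close>, by the pigeonhole principle: the
  \<open>n\<close> differences of a permutation avoid the value 0.

  Equality up to sign is expressed throughout as equality of squares.
\<close>

section \<open>Differences of permutations of the residues\<close>

lemma finite_Zmod [simp]: "finite (Zmod n)"
  by (simp add: Zmod_def)

lemma finite_difference_counts:
  "finite {card {x \<in> Zmod n. (f ((x + a) mod int n) - f x) mod int n = b} | a b.
            a \<in> Zmod n \<and> a \<noteq> 0 \<and> b \<in> Zmod n}"
proof (rule finite_subset)
  show "{card {x \<in> Zmod n. (f ((x + a) mod int n) - f x) mod int n = b} | a b.
            a \<in> Zmod n \<and> a \<noteq> 0 \<and> b \<in> Zmod n} \<subseteq> {..card (Zmod n)}"
    by (auto intro: card_mono)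
qed simp

lemma Zmod_dvd_diff_imp_eq:
  assumes "i \<in> Zmod n" "j \<in> Zmod n" "int n dvd i - j"
  shows "i = j"
proof -
  have "i mod int n = j mod int n"
    using assms(3) by (simp add: mod_eq_dvd_iff)
  thus ?thesis
    using assms(1,2) by (simp add: Zmod_def)
qed

text \<open>
  The differences of a permutation in direction 1 are nonzero, so the \<open>n\<close> arguments share at most
  \<open>n - 1\<close> values.
\<close>

lemma differential_uniformity_permutation_ge_2:
  assumes bij: "bij_betw f (Zmod n) (Zmod n)" and n: "n > 1"
  shows "differential_uniformity n f \<ge> 2"
proof -
  define D where "D = (\<lambda>x. (f ((x + 1) mod int n) - f x) mod int n)"
  have shift: "(x + 1) mod int n \<in> Zmod n" for x
    using n by (simp add: Zmod_def)
  have "D x \<in> Zmod n - {0}" if x: "x \<in> Zmod n" for x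
  proof -
    have "D x \<noteq> 0"
    proof
      assume "D x = 0"
      hence "int n dvd f ((x + 1) mod int n) - f x"
        by (simp add: D_def mod_eq_0_iff_dvd)
      moreover have "f ((x + 1) mod int n) \<in> Zmod n" "f x \<in> Zmod n"
        using bij x shift by (auto dest: bij_betwE)
      ultimately have "f ((x + 1) mod int n) = f x"
        by (blast intro: Zmod_dvd_diff_imp_eq)
      hence "(x + 1) mod int n = x"
        using bij x shift by (metis bij_betw_imp_inj_on inj_onD)
      hence "(x + 1) mod int n = x mod int n"
        using x by (simp add: Zmod_def)
      hence "int n dvd 1"
        by (simp add: mod_eq_dvd_iff)
      thus False
        using n by simp
    qed
    thus ?thesis
      using n by (simp add: D_def Zmod_def)
  qed
  hence "card (D ` Zmod n) \<le> card (Zmod n - {0})"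
    by (intro card_mono) auto
  also have "\<dots> < card (Zmod n)"
    using n by (intro card_Diff1_less) (simp_all add: Zmod_def)
  finally have "\<not> inj_on D (Zmod n)"
    by (rule pigeonhole)
  then obtain x y where xy: "x \<in> Zmod n" "y \<in> Zmod n" "x \<noteq> y" "D x = D y"
    by (auto simp: inj_on_def)
  have "2 = card {x, y}"
    using xy by simp
  also have "\<dots> \<le> card {z \<in> Zmod n. (f ((z + 1) mod int n) - f z) mod int n = D x}"
    using xy by (intro card_mono) (auto simp: D_def)
  also have "\<dots> \<le> differential_uniformity n f"
    unfolding differential_uniformity_def
    by (intro Max_ge finite_difference_counts CollectI exI[of _ 1] exI[of _ "D x"])
       (use n in \<open>auto simp: D_def Zmod_def\<close>)
  finally show ?thesis .
qed

lemma differential_uniformity_le: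
  assumes "n > 1"
    and "\<And>a b. a \<in> Zmod n \<Longrightarrow> a \<noteq> 0 \<Longrightarrow>
           card {x \<in> Zmod n. (f ((x + a) mod int n) - f x) mod int n = b} \<le> m"
  shows "differential_uniformity n f \<le> m"
proof -
  have "1 \<in> Zmod n" "0 \<in> Zmod n"
    using assms(1) by (auto simp: Zmod_def)
  hence "{card {x \<in> Zmod n. (f ((x + a) mod int n) - f x) mod int n = b} | a b.
            a \<in> Zmod n \<and> a \<noteq> 0 \<and> b \<in> Zmod n} \<noteq> {}"
    by fastforce
  thus ?thesis
    unfolding differential_uniformity_def
    using assms(2) by (subst Max_le_iff[OF finite_difference_counts]) auto
qed

section \<open>Primitive elements\<close>

lemma primitive_element_nonzero:
  assumes "primitive_element \<alpha>"
  shows "\<alpha> \<noteq> 0"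
proof -
  have "\<alpha> powi 1 \<in> {x. x \<noteq> 0}"
    using assms unfolding primitive_element_def by blast
  thus ?thesis
    by simp
qed

lemma primitive_element_powiE:
  assumes "primitive_element \<alpha>" "x \<noteq> 0"
  obtains i :: int where "x = \<alpha> powi i"
  using assms unfolding primitive_element_def by blast

lemma powi_mod_exponent:
  fixes \<alpha> :: "'a::field"
  assumes "\<alpha> \<noteq> 0" "\<alpha> ^ r = 1"
  shows "\<alpha> powi i = \<alpha> powi (i mod int r)"
proof -
  have "\<alpha> powi i = \<alpha> powi (int r * (i div int r) + i mod int r)"
    by simp
  also have "\<dots> = (\<alpha> ^ r) powi (i div int r) * \<alpha> powi (i mod int r)"
    using assms(1) by (simp only: power_int_add power_int_power simp_thms)
  finally show ?thesis
    using assms(2) by simp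
qed

lemma primitive_element_exponent_ge:
  fixes \<alpha> :: "'a::{field, finite}"
  assumes prim: "primitive_element \<alpha>" and r: "r > 0" "\<alpha> ^ r = 1"
  shows "CARD('a) - 1 \<le> r"
proof -
  have "{x. x \<noteq> 0} \<subseteq> (\<lambda>i. \<alpha> ^ i) ` {..<r}"
  proof
    fix x :: 'a assume "x \<in> {x. x \<noteq> 0}"
    then obtain i where "x = \<alpha> powi i"
      using prim by (auto elim: primitive_element_powiE)
    also have "\<dots> = \<alpha> powi (i mod int r)"
      using prim r by (intro powi_mod_exponent primitive_element_nonzero)
    also have "\<dots> = \<alpha> ^ nat (i mod int r)"
      using r by (intro power_int_nonneg_exp) simp
    finally show "x \<in> (\<lambda>i. \<alpha> ^ i) ` {..<r}"
      using r by (auto simp: nat_less_iff)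
  qed
  hence "card {x::'a. x \<noteq> 0} \<le> card {..<r}"
    by (intro surj_card_le) auto
  moreover have "{x::'a. x \<noteq> 0} = UNIV - {0}"
    by auto
  ultimately show ?thesis
    by (simp add: card_Diff_singleton)
qed

text \<open>
  Two of the exponents from 0 to \<open>N = CARD('a) - 1\<close> give the same power, and their difference is a
  period of length at most \<open>N\<close>; shorter periods would not leave enough powers to fill the field.
\<close>

lemma primitive_element_power_order:
  fixes \<alpha> :: "'a::{field, finite}"
  assumes prim: "primitive_element \<alpha>"
  shows "\<alpha> ^ (CARD('a) - 1) = 1"
proof -
  define N where "N = CARD('a) - 1"
  have nz: "\<alpha> \<noteq> 0"
    using prim by (rule primitive_element_nonzero)
  have "card ((\<lambda>i. \<alpha> ^ i) ` {..N}) \<le> card (UNIV - {0::'a})"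
    using nz by (intro card_mono) auto
  also have "\<dots> < card {..N}"
    by (simp add: N_def card_Diff_singleton)
  finally have "\<not> inj_on (\<lambda>i. \<alpha> ^ i) {..N}"
    by (rule pigeonhole)
  then obtain i j where ij: "i < j" "j \<le> N" "\<alpha> ^ i = \<alpha> ^ j"
    unfolding inj_on_def by (metis atMost_iff linorder_neqE_nat)
  have "\<alpha> ^ i * \<alpha> ^ (j - i) = \<alpha> ^ i * 1"
    using ij(1,3) by (metis le_add_diff_inverse less_imp_le mult.right_neutral power_add)
  hence period: "\<alpha> ^ (j - i) = 1"
    using nz by simp
  hence "N \<le> j - i"
    unfolding N_def using prim ij by (intro primitive_element_exponent_ge) auto
  hence "j - i = N"
    using ij by simp
  thus ?thesis
    using period by (simp add: N_def)
qed

lemma primitive_element_powi_eq_1_iff: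
  fixes \<alpha> :: "'a::{field, finite}"
  assumes prim: "primitive_element \<alpha>"
  shows "\<alpha> powi m = 1 \<longleftrightarrow> int (CARD('a) - 1) dvd m"
proof -
  define N where "N = CARD('a) - 1"
  define r where "r = nat (m mod int N)"
  have N: "\<alpha> ^ N = 1"
    unfolding N_def using prim by (rule primitive_element_power_order)
  have "N > 0"
    using card_mono[of "UNIV :: 'a set" "{0, 1}"] by (simp add: N_def)
  hence r: "int r = m mod int N" "r < N"
    by (auto simp: r_def nat_less_iff)
  have "\<alpha> powi m = \<alpha> ^ r"
    using powi_mod_exponent[OF primitive_element_nonzero[OF prim] N, of m]
    by (simp flip: r(1))
  moreover have "\<alpha> ^ r = 1 \<longleftrightarrow> r = 0"
    using primitive_element_exponent_ge[OF prim, of r] r(2) by (cases "r = 0") (auto simp: N_def)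
  ultimately show ?thesis
    unfolding N_def[symmetric] dvd_eq_mod_eq_0 r(1)[symmetric] by simp
qed

section \<open>Fields with a power of 3 elements\<close>

lemma CHAR_eq_3:
  assumes "CARD('a::{field, finite}) = 3 ^ d"
  shows "CHAR('a) = 3"
proof -
  have prime: "prime CHAR('a)"
    by (intro prime_CHAR_semidom finite_imp_CHAR_pos) simp
  moreover have "CHAR('a) dvd 3 ^ d"
    using CHAR_dvd_CARD[where ?'a = 'a] assms by simp
  ultimately have "CHAR('a) dvd 3"
    by (rule prime_dvd_power)
  thus ?thesis
    using prime by (simp add: primes_dvd_imp_eq)
qed

lemma power_iterate_fixed:
  fixes x :: "'a::monoid_mult"
  assumes "x ^ m = x"
  shows "x ^ (m ^ u) = x"
  by (induction u) (simp_all add: assms power_mult)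

text \<open>
  With \<open>s * u = d * v + 1\<close>, iterating \<open>x \<mapsto> x ^ 3 ^ s\<close> \<open>u\<close> times amounts to iterating \<open>x \<mapsto> x ^ 3 ^ d\<close>
  \<open>v\<close> times and cubing once. Hence a common fixed point satisfies \<open>x ^ 3 = x\<close>.
\<close>

lemma frobenius_fixed_imp_sign:
  fixes x :: "'a::field"
  assumes "x \<noteq> 0" "x ^ 3 ^ s = x" "x ^ 3 ^ d = x" "s > 0" "gcd s d = 1"
  shows "x\<^sup>2 = 1"
proof -
  obtain u v where uv: "s * u = d * v + 1"
    using bezout_nat[of s d] assms(4,5) by auto
  have "x ^ (3 ^ d) ^ v = x"
    using assms(3) by (rule power_iterate_fixed)
  hence "x ^ 3 = (x ^ (3 ^ d) ^ v) ^ 3"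
    by simp
  also have "\<dots> = x ^ (3 ^ s) ^ u"
    using uv by (simp add: mult.commute flip: power_mult power_Suc)
  also have "\<dots> = x"
    using assms(2) by (rule power_iterate_fixed)
  finally have "x * x\<^sup>2 = x * 1"
    by (simp add: power3_eq_cube power2_eq_square)
  thus ?thesis
    using assms(1) by simp
qed

section \<open>A linearized binomial with trivial kernel\<close>

definition linearized_binomial :: "nat \<Rightarrow> 'a::field \<Rightarrow> 'a \<Rightarrow> 'a" where
  "linearized_binomial s c y = y ^ 3 ^ s + c * y"

lemma H_eq_linearized_binomial: "H k c s x = linearized_binomial s c (x ^ k)"
  by (simp add: H_def linearized_binomial_def power_mult)

lemma linearized_binomial_add:
  assumes "CHAR('a::field) = 3"
  shows "linearized_binomial s c (y + z :: 'a) = linearized_binomial s c y + linearized_binomial s c z"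
proof -
  have "(y + z) ^ 3 ^ s = y ^ 3 ^ s + z ^ 3 ^ s"
    by (rule freshmans_dream') (simp_all add: assms)
  thus ?thesis
    by (simp add: linearized_binomial_def algebra_simps)
qed

lemma linearized_binomial_minus:
  "linearized_binomial s c (- y) = - linearized_binomial s c y"
  by (simp add: linearized_binomial_def)

lemma linearized_binomial_cong_sign:
  assumes "y\<^sup>2 = z\<^sup>2"
  shows "(linearized_binomial s c y)\<^sup>2 = (linearized_binomial s c z)\<^sup>2"
  using assms by (auto simp: power2_eq_iff linearized_binomial_minus)

text \<open>
  A nonzero root would make \<open>- c = y ^ (3 ^ s - 1)\<close>, whose exponent is even.
\<close>

lemma linearized_binomial_nonzero:
  assumes "admissible c" "y \<noteq> 0"
  shows "linearized_binomial s c y \<noteq> 0"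
proof
  assume zero: "linearized_binomial s c y = 0"
  have "odd (3 ^ s :: nat)"
    by simp
  then obtain m :: nat where "3 ^ s = 2 * m + 1"
    by (rule oddE)
  hence "y * (y ^ m)\<^sup>2 = y * (- c)"
    using zero by (simp add: linearized_binomial_def eq_neg_iff_add_eq_0 power_mult power2_eq_square
        power_mult_distrib mult_ac)
  hence "(y ^ m)\<^sup>2 = - c"
    using assms(2) by (simp only: mult_cancel_left simp_thms)
  hence "is_square (- c)"
    by (intro is_nth_powerI) (rule sym)
  thus False
    using assms(1) by (simp add: admissible_def)
qed

lemma linearized_binomial_inj_sign:
  assumes "CHAR('a::field) = 3" "admissible c"
    and eq: "(linearized_binomial s c y)\<^sup>2 = (linearized_binomial s c (z::'a))\<^sup>2"
  shows "y\<^sup>2 = z\<^sup>2"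
proof -
  have "linearized_binomial s c (y + - z) = linearized_binomial s c y - linearized_binomial s c z"
    by (simp only: linearized_binomial_add[OF assms(1)] linearized_binomial_minus) simp
  hence "linearized_binomial s c (y + - z) = 0 \<or> linearized_binomial s c (y + z) = 0"
    using eq by (auto simp: power2_eq_iff linearized_binomial_add[OF assms(1)])
  hence "y + - z = 0 \<or> y + z = 0"
    using linearized_binomial_nonzero[OF assms(2)] by blast
  thus ?thesis
    by (auto simp: power2_eq_iff eq_neg_iff_add_eq_0)
qed

text \<open>
  The equation \<open>L (t * y) = \<gamma> * L y\<close> is \<open>y ^ q * (t ^ q - \<gamma>) = - c * y * (t - \<gamma>)\<close>. If the factor
  \<open>t ^ q - \<gamma>\<close> vanished, so would \<open>t - \<gamma>\<close>, making \<open>t\<close> a fixed point of \<open>x \<mapsto> x ^ q\<close>. Otherwise the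
  equation prescribes \<open>y ^ (q - 1)\<close>, so the quotient of two solutions is such a fixed point.
  Nonzero fixed points are \<open>\<plusminus> 1\<close> by assumption.
\<close>

lemma twisted_eigenvector_unique:
  fixes t \<gamma> c y z :: "'a::field"
  assumes fixed: "\<And>x::'a. x \<noteq> 0 \<Longrightarrow> x ^ 3 ^ s = x \<Longrightarrow> x\<^sup>2 = 1"
    and nz: "c \<noteq> 0" "t \<noteq> 0" "y \<noteq> 0" "z \<noteq> 0" and t: "t\<^sup>2 \<noteq> 1"
    and y: "linearized_binomial s c (t * y) = \<gamma> * linearized_binomial s c y"
    and z: "linearized_binomial s c (t * z) = \<gamma> * linearized_binomial s c z"
  shows "y\<^sup>2 = z\<^sup>2"
proof -
  define q :: nat where "q = 3 ^ s"
  have y': "y ^ q * (t ^ q - \<gamma>) = - c * y * (t - \<gamma>)"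
    using y by (simp add: linearized_binomial_def q_def algebra_simps)
  have z': "z ^ q * (t ^ q - \<gamma>) = - c * z * (t - \<gamma>)"
    using z by (simp add: linearized_binomial_def q_def algebra_simps)
  have "t ^ q \<noteq> \<gamma>"
  proof
    assume "t ^ q = \<gamma>"
    moreover from this have "t = \<gamma>"
      using y' nz by simp
    ultimately have "t ^ 3 ^ s = t"
      by (simp add: q_def)
    thus False
      using fixed nz t by blast
  qed
  moreover have "(y ^ q * z) * (t ^ q - \<gamma>) = (z ^ q * y) * (t ^ q - \<gamma>)"
    using y' z' by (simp add: mult_ac)
  ultimately have "y ^ q * z = z ^ q * y"
    by simp
  hence "(y / z) ^ 3 ^ s = y / z"
    using nz by (simp add: q_def field_simps)
  hence "(y / z)\<^sup>2 = 1"
    using nz by (intro fixed) auto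
  thus ?thesis
    using nz by (simp add: field_simps)
qed

section \<open>The logarithmic map\<close>

locale ternary_log =
  fixes \<alpha> :: "'a::{field, finite}" and d s n k :: nat
  assumes d: "d \<ge> 2" and s: "s \<ge> 1" and coprime_s_d: "gcd s d = 1"
    and n_eq: "n = (3 ^ d - 1) div 2"
    and card: "CARD('a) = 3 ^ d"
    and prim: "primitive_element \<alpha>"
    and coprime_k_n: "gcd k n = 1"
begin

lemma alpha_nonzero [simp]: "\<alpha> \<noteq> 0"
  using prim by (rule primitive_element_nonzero)

lemma card_minus_1: "CARD('a) - 1 = 2 * n"
proof -
  have "even (3 ^ d - 1 :: nat)"
    by simp
  thus ?thesis
    by (simp add: card n_eq)
qed

lemma n_gt_1: "n > 1"
proof -
  have "(3::nat) ^ 2 \<le> 3 ^ d"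
    using d by (intro power_increasing) auto
  thus ?thesis
    by (simp add: n_eq)
qed

lemma char: "CHAR('a) = 3"
  using card by (rule CHAR_eq_3)

lemma powi_square_eq_iff: "(\<alpha> powi i)\<^sup>2 = (\<alpha> powi j)\<^sup>2 \<longleftrightarrow> int n dvd i - j"
proof -
  have "(\<alpha> powi i)\<^sup>2 = (\<alpha> powi j)\<^sup>2 \<longleftrightarrow> \<alpha> powi (2 * (i - j)) = 1"
    by (simp add: power_int_diff power_int_power' mult.commute[of _ 2] right_diff_distrib)
  also have "\<dots> \<longleftrightarrow> int n dvd i - j"
    by (simp only: primitive_element_powi_eq_1_iff[OF prim] card_minus_1 of_nat_mult
        of_nat_numeral dvd_mult_cancel_left) simp
  finally show ?thesis .
qed

lemma power_field_size: "x ^ 3 ^ d = (x::'a)"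
proof (cases "x = 0")
  case False
  then obtain i where i: "x = \<alpha> powi i"
    using prim False by (elim primitive_element_powiE)
  have "x ^ (CARD('a) - 1) = 1"
    by (simp only: i power_int_power' primitive_element_powi_eq_1_iff[OF prim]) simp
  moreover have "x ^ 3 ^ d = x * x ^ (CARD('a) - 1)"
    by (simp add: card flip: power_Suc)
  ultimately show ?thesis
    by simp
qed simp

lemma frobenius_fixed: "x ^ 3 ^ s = x \<Longrightarrow> x\<^sup>2 = 1" if "x \<noteq> 0" for x :: 'a
  using frobenius_fixed_imp_sign[OF that _ power_field_size, of s] s coprime_s_d by simp

lemma ex1_log:
  assumes "x \<noteq> 0"
  shows "\<exists>!j. j \<in> Zmod n \<and> x \<in> {\<alpha> powi j, - (\<alpha> powi j)}"
proof -
  obtain m where m: "x = \<alpha> powi m"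
    using prim assms by (rule primitive_element_powiE)
  have "\<exists>!j. j \<in> Zmod n \<and> int n dvd m - j"
  proof (rule ex1I)
    show "m mod int n \<in> Zmod n \<and> int n dvd m - m mod int n"
      using n_gt_1 by (simp add: Zmod_def)
    show "j = m mod int n" if "j \<in> Zmod n \<and> int n dvd m - j" for j
      using that by (simp add: Zmod_def flip: mod_eq_dvd_iff)
  qed
  moreover have "x \<in> {\<alpha> powi j, - (\<alpha> powi j)} \<longleftrightarrow> int n dvd m - j" for j
    by (simp add: m flip: power2_eq_iff powi_square_eq_iff)
  ultimately show ?thesis
    by simp
qed

lemma H_powi: "H k c s (\<alpha> powi i) = linearized_binomial s c (\<alpha> powi (int k * i))"
  by (simp add: H_eq_linearized_binomial power_int_power' mult.commute)

lemma dvd_k_mult_iff: "int n dvd int k * i \<longleftrightarrow> int n dvd i"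
proof -
  have "coprime (int n) (int k)"
    using coprime_k_n by (simp add: coprime_iff_gcd_eq_1 gcd.commute)
  thus ?thesis
    by (rule coprime_dvd_mult_right_iff)
qed

context
  fixes c :: 'a
  assumes adm: "admissible c"
begin

lemma ex1_F: "\<exists>!j. j \<in> Zmod n \<and> H k c s (\<alpha> powi i) \<in> {\<alpha> powi j, - (\<alpha> powi j)}"
  by (intro ex1_log) (simp add: H_powi linearized_binomial_nonzero adm)

lemma F_in_Zmod: "F \<alpha> n k c s i \<in> Zmod n"
  and F_square: "(linearized_binomial s c (\<alpha> powi (int k * i)))\<^sup>2 = (\<alpha> powi (F \<alpha> n k c s i))\<^sup>2"
  using theI'[OF ex1_F[of i], folded F_def] by (auto simp: H_powi power2_eq_iff)

lemma F_eq_iff: "F \<alpha> n k c s i = F \<alpha> n k c s j \<longleftrightarrow> int n dvd i - j"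
proof -
  let ?y = "\<lambda>i. \<alpha> powi (int k * i)"
  have "F \<alpha> n k c s i = F \<alpha> n k c s j \<longleftrightarrow>
          (\<alpha> powi (F \<alpha> n k c s i))\<^sup>2 = (\<alpha> powi (F \<alpha> n k c s j))\<^sup>2"
    using Zmod_dvd_diff_imp_eq[OF F_in_Zmod F_in_Zmod] by (auto simp: powi_square_eq_iff)
  also have "\<dots> \<longleftrightarrow> (linearized_binomial s c (?y i))\<^sup>2 = (linearized_binomial s c (?y j))\<^sup>2"
    by (simp add: F_square)
  also have "\<dots> \<longleftrightarrow> (?y i)\<^sup>2 = (?y j)\<^sup>2"
    using linearized_binomial_cong_sign linearized_binomial_inj_sign[OF char adm] by blast
  also have "\<dots> \<longleftrightarrow> int n dvd i - j"
    by (simp add: powi_square_eq_iff dvd_k_mult_iff flip: right_diff_distrib)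
  finally show ?thesis .
qed

lemma F_mod: "F \<alpha> n k c s (i mod int n) = F \<alpha> n k c s i"
  by (subst F_eq_iff) (simp add: flip: mod_eq_dvd_iff)

lemma F_permutation: "bij_betw (F \<alpha> n k c s) (Zmod n) (Zmod n)"
proof -
  have "inj_on (F \<alpha> n k c s) (Zmod n)"
    by (auto intro!: inj_onI simp: F_eq_iff intro: Zmod_dvd_diff_imp_eq)
  moreover have "F \<alpha> n k c s ` Zmod n \<subseteq> Zmod n"
    using F_in_Zmod by blast
  ultimately show ?thesis
    by (simp add: bij_betw_def endo_inj_surj)
qed

lemma card_difference_solutions_le_2:
  assumes a: "a \<in> Zmod n" "a \<noteq> 0"
  shows "card {x \<in> Zmod n. (F \<alpha> n k c s ((x + a) mod int n) - F \<alpha> n k c s x) mod int n = b} \<le> 2"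
    (is "card ?S \<le> 2")
proof -
  define t where "t = \<alpha> powi (int k * a)"
  define y where "y = (\<lambda>x. \<alpha> powi (int k * x))"
  define S where "S = (\<lambda>\<gamma>. {x \<in> Zmod n. linearized_binomial s c (t * y x) =
                                          \<gamma> * linearized_binomial s c (y x)})"
  have t: "t\<^sup>2 \<noteq> 1"
  proof
    assume "t\<^sup>2 = 1"
    hence "(\<alpha> powi (int k * a))\<^sup>2 = (\<alpha> powi 0)\<^sup>2"
      by (simp add: t_def)
    hence "int n dvd a - 0"
      unfolding powi_square_eq_iff by (simp add: dvd_k_mult_iff)
    hence "a = 0"
      using a n_gt_1 by (intro Zmod_dvd_diff_imp_eq) (auto simp: Zmod_def)
    thus False
      using a by simp
  qed
  have "card (S \<gamma>) \<le> 1" for \<gamma>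
  proof -
    have "x = z" if xz: "x \<in> S \<gamma>" "z \<in> S \<gamma>" for x z
    proof -
      have "(y x)\<^sup>2 = (y z)\<^sup>2"
      proof (rule twisted_eigenvector_unique[where s = s and c = c and t = t and \<gamma> = \<gamma>])
        show "c \<noteq> 0"
          using adm by (simp add: admissible_def)
      qed (use xz t frobenius_fixed in \<open>auto simp: S_def t_def y_def\<close>)
      hence "int n dvd x - z"
        by (simp add: y_def powi_square_eq_iff dvd_k_mult_iff flip: right_diff_distrib)
      thus ?thesis
        using xz by (intro Zmod_dvd_diff_imp_eq) (auto simp: S_def)
    qed
    moreover have "finite (S \<gamma>)"
      by (simp add: S_def)
    ultimately show ?thesis
      by (auto simp: card_le_Suc0_iff_eq)
  qed
  note card_S = this
  have "?S \<subseteq> S (\<alpha> powi b) \<union> S (- (\<alpha> powi b))"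
  proof
    fix x assume x: "x \<in> ?S"
    have "(F \<alpha> n k c s (x + a) - F \<alpha> n k c s x) mod int n = b"
      using x by (simp add: F_mod)
    hence "int n dvd F \<alpha> n k c s (x + a) - (b + F \<alpha> n k c s x)"
      by (metis diff_diff_add add.commute dvd_minus_mod)
    \<comment> \<open>Logarithms modulo \<open>n\<close> see field elements up to sign only, hence the two signs of \<open>\<gamma>\<close> below.\<close>
    hence "(\<alpha> powi (F \<alpha> n k c s (x + a)))\<^sup>2 = (\<alpha> powi (b + F \<alpha> n k c s x))\<^sup>2"
      by (simp only: powi_square_eq_iff)
    hence "(linearized_binomial s c (y (x + a)))\<^sup>2 = (\<alpha> powi b * linearized_binomial s c (y x))\<^sup>2"
      by (simp add: y_def F_square power_int_add power_mult_distrib)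
    moreover have "y (x + a) = t * y x"
      by (simp add: y_def t_def distrib_left power_int_add)
    ultimately show "x \<in> S (\<alpha> powi b) \<union> S (- (\<alpha> powi b))"
      using x by (auto simp: S_def power2_eq_iff)
  qed
  hence "card ?S \<le> card (S (\<alpha> powi b) \<union> S (- (\<alpha> powi b)))"
    by (intro card_mono) (auto simp: S_def)
  also have "\<dots> \<le> card (S (\<alpha> powi b)) + card (S (- (\<alpha> powi b)))"
    by (rule card_Un_le)
  also have "\<dots> \<le> 2"
    using card_S[of "\<alpha> powi b"] card_S[of "- (\<alpha> powi b)"] by simp
  finally show ?thesis .
qed

lemma F_APN_permutation: "APN_permutation n (F \<alpha> n k c s)"
proof -
  have "differential_uniformity n (F \<alpha> n k c s) \<le> 2"
    using n_gt_1 card_difference_solutions_le_2 by (rule differential_uniformity_le)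
  moreover have "differential_uniformity n (F \<alpha> n k c s) \<ge> 2"
    using F_permutation n_gt_1 by (rule differential_uniformity_permutation_ge_2)
  ultimately show ?thesis
    using F_permutation by (simp add: APN_permutation_def APN_def)
qed

end

text \<open>
  The group of units has even order \<open>2 * n\<close>, so \<open>\<alpha> powi m = \<alpha>\<close> forces \<open>m\<close> to be odd,
  whereas the square of a power of \<open>\<alpha>\<close> is an even power.
\<close>

lemma admissible_uminus_primitive: "admissible (- \<alpha>)"
proof -
  have "\<not> is_square \<alpha>"
  proof
    assume "is_square \<alpha>"
    then obtain y where y: "\<alpha> = y\<^sup>2"
      by (rule is_nth_powerE)
    hence "y \<noteq> 0"
      using alpha_nonzero by auto
    then obtain i where i: "y = \<alpha> powi i"
      using prim by (elim primitive_element_powiE)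
    have "\<alpha> powi (2 * i) = y\<^sup>2"
      by (simp only: i power_int_power' mult.commute) simp
    hence "\<alpha> powi (2 * i) = \<alpha>"
      by (simp only: y)
    hence "\<alpha> powi (2 * i - 1) = 1"
      by (simp add: power_int_diff)
    hence "int (2 * n) dvd 2 * i - 1"
      by (simp only: primitive_element_powi_eq_1_iff[OF prim] card_minus_1)
    hence "even (2 * i - 1)"
      by (rule dvd_trans[rotated]) simp
    thus False
      by simp
  qed
  thus ?thesis
    by (simp add: admissible_def)
qed

end

theorem theorem4:
  fixes \<alpha> :: "'a::{field, finite}" and d s n k :: nat
  assumes "d \<ge> 2" and "s \<ge> 1" and "gcd s d = 1"
    and "n = (3 ^ d - 1) div 2"
    and "CARD('a) = 3 ^ d"
    and "primitive_element \<alpha>"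
    and "k > 0" and "gcd k n = 1"
  shows "(\<forall>c. admissible c \<longrightarrow>
            (\<forall>i::int. \<exists>!j. j \<in> Zmod n \<and>
               H k c s (\<alpha> powi i) \<in> {\<alpha> powi j, - (\<alpha> powi j)}) \<and>
            (\<forall>i::int. F \<alpha> n k c s (i mod int n) = F \<alpha> n k c s i) \<and>
            APN_permutation n (F \<alpha> n k c s)) \<and>
         admissible (- \<alpha>) \<and> APN_permutation n (F \<alpha> n k (- \<alpha>) s)"
proof -
  interpret ternary_log \<alpha> d s n k
    using assms by unfold_locales
  show ?thesis
    using ex1_F F_mod F_APN_permutation admissible_uminus_primitive by blast
qed

end
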